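(* Let $G$ be a subgroup of the symmetric group $S_n$, let $\mathbf{a} \in \mathbb{R}^n$ have nonnegative coordinates, and let $K_G(\mathbf{a})$ be the convex hull of the finite set $\{\gamma\mathbf{a} : \gamma \in G\}$. If $\mathbf{b} \in K_G(\mathbf{a})$, then \[ [\mathbf{x}^{\mathbf{b}}]_G \le [\mathbf{x}^{\mathbf{a}}]_G \] for every vector $\mathbf{x} \in \mathbb{R}^n$ with positive coordinates.
   Context: $S_n$ acts on $\mathbb{R}^n$ by $\gamma (a_1,\ldots,a_n)^T = (a_{\gamma^{-1}(1)},\ldots,a_{\gamma^{-1}(n)})^T$. For a nonnegative vector $\mathbf{a}$ and a vector $\mathbf{x}=(x_1,\ldots,x_n)^T$ with positive coordinates, $[\mathbf{x}^{\mathbf{a}}]_G = \frac{1}{|G|}\sum_{\sigma\in G} x_{\sigma(1)}^{a_1}\cdots x_{\sigma(n)}^{a_n}$. *)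

theory Defs
  imports "HOL-Analysis.Analysis" "HOL-Algebra.Bij"
begin

(* The symmetric group S_n, n = CARD('n), is BijGroup (UNIV :: 'n set); on UNIV the
   restrictions in its definition vanish: *)

lemma carrier_BijGroup_UNIV: "carrier (BijGroup UNIV) = {p. bij p}"
  by (auto simp: BijGroup_def Bij_def)

lemma mult_BijGroup_UNIV:
  "bij p \<Longrightarrow> bij q \<Longrightarrow> p \<otimes>\<^bsub>BijGroup UNIV\<^esub> q = p \<circ> q"
  by (auto simp: BijGroup_def Bij_def compose_def)

(* inv_into UNIV is spelled out because HOL-Algebra overloads the notation for inv. *)
definition perm_act :: "('n::finite \<Rightarrow> 'n) \<Rightarrow> real ^ 'n \<Rightarrow> real ^ 'n" where
  "perm_act \<gamma> a = (\<chi> i. a $ (inv_into UNIV \<gamma> i))"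

definition K_hull :: "('n::finite \<Rightarrow> 'n) set \<Rightarrow> real ^ 'n \<Rightarrow> (real ^ 'n) set" where
  "K_hull G a = convex hull {perm_act \<gamma> a | \<gamma>. \<gamma> \<in> G}"

(* Intended for x with positive coordinates, where powr is the usual real power. *)
definition sym_mean :: "('n::finite \<Rightarrow> 'n) set \<Rightarrow> real ^ 'n \<Rightarrow> real ^ 'n \<Rightarrow> real" where
  "sym_mean G x a = (1 / real (card G)) * (\<Sum>\<sigma>\<in>G. \<Prod>i\<in>UNIV. (x $ \<sigma> i) powr (a $ i))"

end

theory Submission
  imports Defs
begin

text \<open>For fixed \<open>x\<close> with positive coordinates, each monomial is the exponential of a linear
  function of the exponent vector, so the symmetrised mean is convex in the exponent. It is
  also constant on the \<open>G\<close>-orbit of \<open>a\<close>, so its sublevel set at the value in \<open>a\<close> is a convex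
  set containing that orbit, hence contains the convex hull of the orbit.\<close>

lemma prod_powr_eq_exp_inner:
  fixes a y :: "real ^ 'n::finite"
  assumes "\<And>i. 0 < y $ i"
  shows "(\<Prod>i\<in>UNIV. (y $ i) powr (a $ i)) = exp ((\<chi> i. ln (y $ i)) \<bullet> a)"
proof -
  have "(\<Prod>i\<in>UNIV. (y $ i) powr (a $ i)) = (\<Prod>i\<in>UNIV. exp (ln (y $ i) * a $ i))"
    \<comment> \<open>Positivity excludes the base 0, where \<open>powr\<close> takes the value 0 by
      convention.\<close>
    using assms by (intro prod.cong) (auto simp: powr_def mult.commute less_imp_neq[symmetric])
  then show ?thesis
    by (simp add: exp_sum inner_vec_def)
qed

lemma convex_on_exp_inner:
  fixes v :: "'a::real_inner"
  shows "convex_on UNIV (\<lambda>a. exp (v \<bullet> a))"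
proof (rule convex_onI)
  fix t :: real and a b :: 'a
  assume "0 < t" "t < 1"
  then show "exp (v \<bullet> ((1 - t) *\<^sub>R a + t *\<^sub>R b)) \<le> (1 - t) * exp (v \<bullet> a) + t * exp (v \<bullet> b)"
    using convex_onD[OF exp_convex, of t "v \<bullet> a" "v \<bullet> b"] by (simp add: inner_add_right)
qed simp

lemma convex_on_sum_functions:
  fixes f :: "'i \<Rightarrow> 'a::real_vector \<Rightarrow> real"
  assumes "convex S" "\<And>i. i \<in> I \<Longrightarrow> convex_on S (f i)"
  shows "convex_on S (\<lambda>x. \<Sum>i\<in>I. f i x)"
  using assms(2)
proof (induction I rule: infinite_finite_induct)
  case (insert i I)
  then show ?case by (simp add: convex_on_add)
\<comment> \<open>For infinite or empty \<open>I\<close> the sum is the constant 0, which is convex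
  on \<open>S\<close> because \<open>S\<close> is convex.\<close>
qed (simp_all add: convex_on_const assms(1))

lemma convex_on_sym_mean:
  fixes x :: "real ^ 'n::finite"
  assumes "\<And>i. 0 < x $ i"
  shows "convex_on UNIV (sym_mean G x)"
proof -
  have "convex_on UNIV (\<lambda>a. \<Prod>i\<in>UNIV. (x $ \<sigma> i) powr (a $ i))" for \<sigma>
    \<comment> \<open>Here \<sigma> permutes the fixed base vector, so the exponent stays linear in
      \<open>a\<close>.\<close>
    using prod_powr_eq_exp_inner[of "\<chi> i. x $ \<sigma> i"] assms by (simp add: convex_on_exp_inner)
  then show ?thesis
    unfolding sym_mean_def by (intro convex_on_cmul convex_on_sum_functions) auto
qed

text \<open>Reindexing the product along \<gamma> cancels the inverse in \<open>perm_act\<close> and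
  moves the action from the exponents to the index \<sigma>.\<close>

lemma prod_powr_perm_act:
  fixes a x :: "real ^ 'n::finite"
  assumes "bij \<gamma>"
  shows "(\<Prod>i\<in>UNIV. (x $ \<sigma> i) powr (perm_act \<gamma> a $ i))
       = (\<Prod>i\<in>UNIV. (x $ (\<sigma> \<circ> \<gamma>) i) powr (a $ i))"
  using prod.reindex_bij_betw[OF assms, of "\<lambda>i. (x $ \<sigma> i) powr (perm_act \<gamma> a $ i)"]
    bij_is_inj[OF assms]
  by (simp add: perm_act_def)

text \<open>Surjectivity of \<gamma> makes right translation injective; as \<open>G\<close> is
  finite and closed under it, the translation is also onto.\<close>

lemma bij_betw_subgroup_comp_right:
  fixes G :: "('n::finite \<Rightarrow> 'n) set"
  assumes G: "subgroup G (BijGroup UNIV)" and \<gamma>: "\<gamma> \<in> G"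
  shows "bij_betw (\<lambda>\<sigma>. \<sigma> \<circ> \<gamma>) G G"
proof -
  have bij: "bij \<sigma>" if "\<sigma> \<in> G" for \<sigma>
    using subgroup.subset[OF G] that by (auto simp: carrier_BijGroup_UNIV)
  have "(\<lambda>\<sigma>. \<sigma> \<circ> \<gamma>) ` G \<subseteq> G"
    using subgroup.m_closed[OF G _ \<gamma>] bij \<gamma> by (auto simp: mult_BijGroup_UNIV)
  moreover have "inj_on (\<lambda>\<sigma>. \<sigma> \<circ> \<gamma>) G"
    using bij_is_surj[OF bij[OF \<gamma>]] by (auto intro!: inj_onI elim: surj_fun_eq simp: fun_eq_iff)
  ultimately show ?thesis
    by (simp add: bij_betw_def endo_inj_surj)
qed

text \<open>Acting on the exponent by \<gamma> only reorders the summands, by right translation of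
  \<open>G\<close>.\<close>

lemma sym_mean_perm_act:
  fixes G :: "('n::finite \<Rightarrow> 'n) set"
  assumes "subgroup G (BijGroup UNIV)" "\<gamma> \<in> G"
  shows "sym_mean G x (perm_act \<gamma> a) = sym_mean G x a"
proof -
  have "bij \<gamma>"
    using subgroup.subset[OF assms(1)] assms(2) by (auto simp: carrier_BijGroup_UNIV)
  then show ?thesis
    using sum.reindex_bij_betw[OF bij_betw_subgroup_comp_right[OF assms],
        of "\<lambda>\<sigma>. \<Prod>i\<in>UNIV. (x $ \<sigma> i) powr (a $ i)"]
    by (simp add: sym_mean_def prod_powr_perm_act)
qed

theorem mainTheorem10:
  fixes G :: "('n::finite \<Rightarrow> 'n) set" and a b x :: "real ^ 'n"
  assumes "subgroup G (BijGroup (UNIV :: 'n set))"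
    and "\<And>i. 0 \<le> a $ i"
    and "b \<in> K_hull G a"
    and "\<And>i. 0 < x $ i"
  shows "sym_mean G x b \<le> sym_mean G x a"
proof -
  have "\<forall>y\<in>convex hull {perm_act \<gamma> a | \<gamma>. \<gamma> \<in> G}. sym_mean G x y \<le> sym_mean G x a"
    \<comment> \<open>A convex function bounded on a set keeps that bound on the convex hull; on the
      orbit the bound is an equality.\<close>
    using convex_on_subset[OF convex_on_sym_mean[OF assms(4)]]
    by (intro convex_on_convex_hull_bound) (auto simp: sym_mean_perm_act[OF assms(1)])
  then show ?thesis
    using assms(3) by (simp add: K_hull_def)
qed

end
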